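(* Let $\Gamma$ be a semi-equivelar $(d+1)$-colored gem of order $p$ (i.e. with $p$ vertices; $d\ge 2$) which embeds regularly on a surface $S$ with $\chi(S)\ge 1$ (so that the face-cycles at all vertices of this embedding are of the same type). Then the possible embedding types of $\Gamma$ on $S$ are $(4^3)$, $(4,6,8)$, $(4,6,10)$, $(6^2,4^1)$, and $(4^2,q)$ with $q\ge 4$ even. Moreover the order $p$ is as follows: if $\chi(S)=1$, then $p=4,\ 24,\ 60,\ 12,\ q$ for the types $(4^3)$, $(4,6,8)$, $(4,6,10)$, $(6^2,4^1)$, $(4^2,q)$ respectively; if $\chi(S)=2$, then $p=8,\ 48,\ 120,\ 24,\ 2q$ for the types $(4^3)$, $(4,6,8)$, $(4,6,10)$, $(6^2,4^1)$, $(4^2,q)$ respectively.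
   Context: Colored graphs and gems. Let $d\ge 2$ and $\Delta_d=\{0,1,\dots,d\}$. A regular $(d+1)$-colored graph $(\Gamma,\gamma)$ is a finite loopless multigraph $\Gamma$ in which every vertex has degree $d+1$, with a surjective proper edge-coloring $\gamma:E(\Gamma)\to\Delta_d$ (adjacent edges get different colors). Its simplicial cell-complex $\mathcal K(\Gamma)$ is built by taking one $d$-simplex $\sigma(u)$ with vertices labeled by $\Delta_d$ for each vertex $u$ of $\Gamma$, and, for each edge of color $j$ between $u$ and $v$, identifying the $(d-1)$-faces of $\sigma(u)$ and $\sigma(v)$ opposite to the $j$-labeled vertices so that equally labeled vertices coincide. If $|\mathcal K(\Gamma)|$ is PL homeomorphic to a closed connected PL $d$-manifold $M$, then $\Gamma$ is called a ($(d+1)$-colored) gem of $M$ (it represents $M$). Regular embedding. For a cyclic permutation $\varepsilon=(\varepsilon_0,\dots,\varepsilon_d)$ of $\Delta_d$, a regular embedding of $\Gamma$ on a closed surface $S$ is a (2-cell) embedding whose faces are bounded exactly by the bi-colored cycles of $\Gamma$ with colors $\varepsilon_i,\varepsilon_{i+1}$ (indices mod $d+1$). Thus every face is an even-length polygon; $S$ is orientable if $\Gamma$ is bipartite and non-orientable otherwise. Semi-equivelar gem. For a regular embedding of $\Gamma$ on $S$, each vertex has a face-cycle $P_0,\dots,P_d$ (the faces around it in cyclic order); two face-cycles are of the same type if their sequences of face lengths agree up to cyclic shift (a face-cycle may be read in either direction). $\Gamma$ is a semi-equivelar gem of $M$, embedded regularly on $S$, if it is a gem of $M$ with a regular embedding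 on $S$ in which every face has length at least $4$ and the face-cycles at all vertices are of the same type. It is of type $(p_0,\dots,p_d)$ if $P_i$ is a $p_i$-gon; an exponent $p_i^{n_i}$ means $n_i$ adjacent $p_i$-gons. *)

theory Defs
  imports "HOL-Analysis.Analysis" "HOL-Homology.Simplices"
begin

section \<open>Regular colored graphs and their bi-colored cycles\<close>

record ('v, 'e) colored_graph =
  verts :: "'v set"
  edges :: "'e set"
  ends  :: "'e \<Rightarrow> 'v set"
  color :: "'e \<Rightarrow> nat"

text \<open>Parallel edges are allowed (distinct elements of \<open>edges\<close> with the same \<open>ends\<close>);
  looplessness is \<open>card (ends \<Gamma> e) = 2\<close>. The color set is \<open>{..d}\<close>.\<close>

definition regular_colored_graph :: "nat \<Rightarrow> ('v, 'e) colored_graph \<Rightarrow> bool" where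
  "regular_colored_graph d \<Gamma> \<longleftrightarrow>
     finite (verts \<Gamma>) \<and> finite (edges \<Gamma>) \<and>
     (\<forall>e\<in>edges \<Gamma>. ends \<Gamma> e \<subseteq> verts \<Gamma> \<and> card (ends \<Gamma> e) = 2) \<and>
     (\<forall>v\<in>verts \<Gamma>. card {e \<in> edges \<Gamma>. v \<in> ends \<Gamma> e} = d + 1) \<and>
     color \<Gamma> ` edges \<Gamma> = {..d} \<and>
     (\<forall>e\<in>edges \<Gamma>. \<forall>f\<in>edges \<Gamma>.
        e \<noteq> f \<and> ends \<Gamma> e \<inter> ends \<Gamma> f \<noteq> {} \<longrightarrow> color \<Gamma> e \<noteq> color \<Gamma> f)"

definition bicolored_adj :: "('v, 'e) colored_graph \<Rightarrow> nat \<Rightarrow> nat \<Rightarrow> ('v \<times> 'v) set" where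
  "bicolored_adj \<Gamma> a b =
     {(u, w). \<exists>e\<in>edges \<Gamma>. color \<Gamma> e \<in> {a, b} \<and> ends \<Gamma> e = {u, w}}"

text \<open>The subgraph formed by the edges colored \<open>a\<close> or \<open>b\<close> is 2-regular (for \<open>a \<noteq> b\<close>), so
  the bi-colored cycle through \<open>v\<close> is the connected component of \<open>v\<close> in it. It is
  represented by its set of edges; its length is the cardinality of that set.\<close>

definition bicolored_cycle :: "('v, 'e) colored_graph \<Rightarrow> nat \<Rightarrow> nat \<Rightarrow> 'v \<Rightarrow> 'e set" where
  "bicolored_cycle \<Gamma> a b v =
     {e \<in> edges \<Gamma>. color \<Gamma> e \<in> {a, b} \<and> (\<exists>u\<in>ends \<Gamma> e. (v, u) \<in> (bicolored_adj \<Gamma> a b)\<^sup>*)}"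


section \<open>Piecewise linear manifolds and gems\<close>

text \<open>Points of the standard \<open>d\<close>-simplex are given by barycentric coordinates, i.e. functions
  \<open>nat \<Rightarrow> real\<close> supported on \<open>{..d}\<close>. As this function type carries no vector space
  structure, convex combinations are written out coordinatewise.\<close>

definition comb :: "((nat \<Rightarrow> real) \<Rightarrow> real) \<Rightarrow> (nat \<Rightarrow> real) set \<Rightarrow> nat \<Rightarrow> real" where
  "comb w A = (\<lambda>i. \<Sum>a\<in>A. w a * a i)"

definition convex_weights :: "'p set \<Rightarrow> ('p \<Rightarrow> real) set" where
  "convex_weights A = {w. (\<forall>a\<in>A. 0 \<le> w a) \<and> sum w A = 1}"

text \<open>A map on the simplex is piecewise linear if the simplex is a finite union of convex hulls of
  finite sets on each of which the map is affine. Continuity is automatic.\<close>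

definition pl_on_simplex :: "nat \<Rightarrow> ((nat \<Rightarrow> real) \<Rightarrow> 'm::euclidean_space) \<Rightarrow> bool" where
  "pl_on_simplex d h \<longleftrightarrow>
     (\<exists>\<A>. finite \<A> \<and> (\<forall>A\<in>\<A>. finite A \<and> A \<subseteq> standard_simplex d) \<and>
          standard_simplex d = (\<Union>A\<in>\<A>. {comb w A | w. w \<in> convex_weights A}) \<and>
          (\<forall>A\<in>\<A>. \<forall>w\<in>convex_weights A. h (comb w A) = (\<Sum>a\<in>A. w a *\<^sub>R h a)))"

text \<open>As in Rourke--Sanderson, PL manifolds are subsets of some Euclidean space with the PL
  structure inherited from it. A chart at \<open>p\<close> is an injective PL map of the
  \<open>d\<close>-simplex into \<open>M\<close> taking the open simplex onto an open neighbourhood of \<open>p\<close> in \<open>M\<close>.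
  With compactness, \<open>M\<close> is then a finite union of images of charts, hence a compact polyhedron.\<close>

definition closed_connected_pl_manifold :: "nat \<Rightarrow> 'm::euclidean_space set \<Rightarrow> bool" where
  "closed_connected_pl_manifold d M \<longleftrightarrow>
     M \<noteq> {} \<and> compact M \<and> connected M \<and>
     (\<forall>p\<in>M. \<exists>h. pl_on_simplex d h \<and> inj_on h (standard_simplex d) \<and>
        h ` standard_simplex d \<subseteq> M \<and>
        (let U = h ` {x \<in> standard_simplex d. \<forall>i\<le>d. 0 < x i}
         in p \<in> U \<and> openin (top_of_set M) U))"

text \<open>The simplex \<open>\<sigma>(u)\<close> is \<open>{u} \<times> standard_simplex d\<close>; its face opposite to the vertex
  labeled \<open>j\<close> is given by \<open>x j = 0\<close>. Identifying two such faces so that equally labeled vertices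
  coincide means identifying points with equal barycentric coordinates. The relation \<open>glue\<close> is
  symmetric on the disjoint union of the simplices, so its reflexive transitive closure is
  the generated equivalence relation.\<close>

definition glue ::
    "nat \<Rightarrow> ('v, 'e) colored_graph \<Rightarrow> (('v \<times> (nat \<Rightarrow> real)) \<times> ('v \<times> (nat \<Rightarrow> real))) set" where
  "glue d \<Gamma> =
     {((u, x), (v, x)) | u v x. x \<in> standard_simplex d \<and>
        (\<exists>e\<in>edges \<Gamma>. ends \<Gamma> e = {u, v} \<and> x (color \<Gamma> e) = 0)}"

definition cell_point ::
    "nat \<Rightarrow> ('v, 'e) colored_graph \<Rightarrow> 'v \<Rightarrow> (nat \<Rightarrow> real) \<Rightarrow> ('v \<times> (nat \<Rightarrow> real)) set" where
  "cell_point d \<Gamma> u x = (glue d \<Gamma>)\<^sup>* `` {(u, x)}"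

definition realization ::
    "nat \<Rightarrow> ('v, 'e) colored_graph \<Rightarrow> ('v \<times> (nat \<Rightarrow> real)) set set" where
  "realization d \<Gamma> = {cell_point d \<Gamma> u x | u x. u \<in> verts \<Gamma> \<and> x \<in> standard_simplex d}"

text \<open>A PL homeomorphism from \<open>|K(\<Gamma>)|\<close> onto \<open>M\<close> is a bijection that is PL on every closed
  \<open>d\<close>-simplex. It is continuous for the quotient topology, which is compact, so the inverse is
  continuous (and PL) as well.\<close>

definition gem_of :: "nat \<Rightarrow> ('v, 'e) colored_graph \<Rightarrow> 'm::euclidean_space set \<Rightarrow> bool" where
  "gem_of d \<Gamma> M \<longleftrightarrow>
     regular_colored_graph d \<Gamma> \<and> closed_connected_pl_manifold d M \<and>
     (\<exists>h. bij_betw h (realization d \<Gamma>) M \<and>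
          (\<forall>u\<in>verts \<Gamma>. pl_on_simplex d (\<lambda>x. h (cell_point d \<Gamma> u x))))"


section \<open>Closed surfaces and their Euler characteristic\<close>

definition closed_surface :: "'s topology \<Rightarrow> bool" where
  "closed_surface S \<longleftrightarrow>
     topspace S \<noteq> {} \<and> compact_space S \<and> Hausdorff_space S \<and> connected_space S \<and>
     (\<forall>x\<in>topspace S. \<exists>U. openin S U \<and> x \<in> U \<and>
        subtopology S U homeomorphic_space (euclidean :: (real^2) topology))"

definition open_disc :: "'s topology \<Rightarrow> 's set \<Rightarrow> bool" where
  "open_disc S F \<longleftrightarrow> subtopology S F homeomorphic_space top_of_set (ball (0 :: real^2) 1)"

text \<open>The faces of a set \<open>X\<close> (the point set of an embedded graph) are the components of its complement.\<close>

definition faces :: "'s topology \<Rightarrow> 's set \<Rightarrow> 's set set" where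
  "faces S X = connected_components_of (subtopology S (topspace S - X))"

text \<open>A decomposition of \<open>S\<close> into finitely many points (the elements of \<open>P\<close>), open arcs (the
  elements of \<open>A\<close>, whose end points lie in \<open>P\<close> and may coincide) and open discs.\<close>

definition cellular_decomposition :: "'s topology \<Rightarrow> 's set \<Rightarrow> 's set set \<Rightarrow> bool" where
  "cellular_decomposition S P A \<longleftrightarrow>
     finite P \<and> P \<subseteq> topspace S \<and> finite A \<and> pairwise disjnt A \<and>
     (\<forall>a\<in>A. a \<inter> P = {} \<and>
        (\<exists>g. pathin S g \<and> g 0 \<in> P \<and> g 1 \<in> P \<and> inj_on g {0<..<1} \<and> a = g ` {0<..<1})) \<and>
     (\<forall>F\<in>faces S (P \<union> \<Union>A). open_disc S F)"

text \<open>The Euler characteristic of a closed surface: the common value of the numbers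
  (vertices) - (edges) + (faces) over all of its cellular decompositions. It is stated as a
  relation; on closed surfaces it is functional because cellular decompositions exist and all of
  them give the same number.\<close>

definition has_euler_characteristic :: "'s topology \<Rightarrow> int \<Rightarrow> bool" where
  "has_euler_characteristic S chi \<longleftrightarrow>
     (\<exists>P A. cellular_decomposition S P A) \<and>
     (\<forall>P A. cellular_decomposition S P A \<longrightarrow>
        int (card P) - int (card A) + int (card (faces S (P \<union> \<Union>A))) = chi)"


section \<open>Regular embeddings and semi-equivelar gems\<close>

text \<open>\<open>\<phi>\<close> places the vertices and \<open>\<alpha> e\<close> parametrizes the arc representing the edge \<open>e\<close>.\<close>

definition graph_embedding ::
    "('v, 'e) colored_graph \<Rightarrow> 's topology \<Rightarrow> ('v \<Rightarrow> 's) \<Rightarrow> ('e \<Rightarrow> real \<Rightarrow> 's) \<Rightarrow> bool" where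
  "graph_embedding \<Gamma> S \<phi> \<alpha> \<longleftrightarrow>
     inj_on \<phi> (verts \<Gamma>) \<and> \<phi> ` verts \<Gamma> \<subseteq> topspace S \<and>
     (\<forall>e\<in>edges \<Gamma>. pathin S (\<alpha> e) \<and> inj_on (\<alpha> e) {0..1} \<and>
        {\<alpha> e 0, \<alpha> e 1} = \<phi> ` ends \<Gamma> e \<and> \<alpha> e ` {0<..<1} \<inter> \<phi> ` verts \<Gamma> = {}) \<and>
     (\<forall>e\<in>edges \<Gamma>. \<forall>f\<in>edges \<Gamma>. e \<noteq> f \<longrightarrow> \<alpha> e ` {0<..<1} \<inter> \<alpha> f ` {0<..<1} = {})"

definition image_of_edges :: "('e \<Rightarrow> real \<Rightarrow> 's) \<Rightarrow> 'e set \<Rightarrow> 's set" where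
  "image_of_edges \<alpha> C = (\<Union>e\<in>C. \<alpha> e ` {0..1})"

text \<open>A cyclic permutation of the colors is a cyclic arrangement \<open>\<epsilon> 0, \<dots>, \<epsilon> d\<close> of all of them.\<close>

definition color_arrangement :: "nat \<Rightarrow> (nat \<Rightarrow> nat) \<Rightarrow> bool" where
  "color_arrangement d \<epsilon> \<longleftrightarrow> bij_betw \<epsilon> {..d} {..d}"

definition face_cycle_at ::
    "nat \<Rightarrow> ('v, 'e) colored_graph \<Rightarrow> (nat \<Rightarrow> nat) \<Rightarrow> nat \<Rightarrow> 'v \<Rightarrow> 'e set" where
  "face_cycle_at d \<Gamma> \<epsilon> i v = bicolored_cycle \<Gamma> (\<epsilon> i) (\<epsilon> ((i + 1) mod (d + 1))) v"

definition bounding_cycles ::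
    "nat \<Rightarrow> ('v, 'e) colored_graph \<Rightarrow> (nat \<Rightarrow> nat) \<Rightarrow> 'e set set" where
  "bounding_cycles d \<Gamma> \<epsilon> = {face_cycle_at d \<Gamma> \<epsilon> i v | i v. i \<le> d \<and> v \<in> verts \<Gamma>}"

text \<open>The faces are open discs, and taking boundaries is a bijection from the faces to the images of the
  bi-colored cycles in two cyclically consecutive colors. Every edge lies on two
  of these cycles (as \<open>d \<ge> 2\<close>), so each boundary is traversed just once.
  Every vertex lies on an edge, so \<open>image_of_edges \<alpha> (edges \<Gamma>)\<close> is the whole embedded graph.\<close>

definition regular_embedding ::
    "nat \<Rightarrow> ('v, 'e) colored_graph \<Rightarrow> (nat \<Rightarrow> nat) \<Rightarrow> 's topology \<Rightarrow>
     ('v \<Rightarrow> 's) \<Rightarrow> ('e \<Rightarrow> real \<Rightarrow> 's) \<Rightarrow> bool" where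
  "regular_embedding d \<Gamma> \<epsilon> S \<phi> \<alpha> \<longleftrightarrow>
     color_arrangement d \<epsilon> \<and> closed_surface S \<and> graph_embedding \<Gamma> S \<phi> \<alpha> \<and>
     (let \<F> = faces S (image_of_edges \<alpha> (edges \<Gamma>)) in
        (\<forall>F\<in>\<F>. open_disc S F) \<and>
        bij_betw (\<lambda>F. S frontier_of F) \<F> (image_of_edges \<alpha> ` bounding_cycles d \<Gamma> \<epsilon>))"

text \<open>The face lengths around \<open>v\<close>. The faces at \<open>v\<close> with colors
  \<open>\<epsilon> (i-1), \<epsilon> i\<close> and \<open>\<epsilon> i, \<epsilon> (i+1)\<close> share the edge of color \<open>\<epsilon> i\<close> at \<open>v\<close>, so in a regular
  embedding listing them by \<open>i\<close> gives their cyclic order around \<open>v\<close>.\<close>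

definition face_lengths :: "nat \<Rightarrow> ('v, 'e) colored_graph \<Rightarrow> (nat \<Rightarrow> nat) \<Rightarrow> 'v \<Rightarrow> nat list" where
  "face_lengths d \<Gamma> \<epsilon> v = map (\<lambda>i. card (face_cycle_at d \<Gamma> \<epsilon> i v)) [0..<d + 1]"

definition same_type :: "nat list \<Rightarrow> nat list \<Rightarrow> bool" where
  "same_type xs ys \<longleftrightarrow> (\<exists>n. ys = rotate n xs \<or> ys = rotate n (rev xs))"

definition semi_equivelar_gem ::
    "nat \<Rightarrow> ('v, 'e) colored_graph \<Rightarrow> 'm::euclidean_space set \<Rightarrow> (nat \<Rightarrow> nat) \<Rightarrow>
     's topology \<Rightarrow> bool" where
  "semi_equivelar_gem d \<Gamma> M \<epsilon> S \<longleftrightarrow>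
     gem_of d \<Gamma> M \<and> (\<exists>\<phi> \<alpha>. regular_embedding d \<Gamma> \<epsilon> S \<phi> \<alpha>) \<and>
     (\<forall>C\<in>bounding_cycles d \<Gamma> \<epsilon>. 4 \<le> card C) \<and>
     (\<forall>u\<in>verts \<Gamma>. \<forall>v\<in>verts \<Gamma>. same_type (face_lengths d \<Gamma> \<epsilon> u) (face_lengths d \<Gamma> \<epsilon> v))"

definition embedding_type ::
    "nat \<Rightarrow> ('v, 'e) colored_graph \<Rightarrow> (nat \<Rightarrow> nat) \<Rightarrow> nat list \<Rightarrow> bool" where
  "embedding_type d \<Gamma> \<epsilon> t \<longleftrightarrow> (\<forall>v\<in>verts \<Gamma>. same_type (face_lengths d \<Gamma> \<epsilon> v) t)"

end

theory Submission
  imports Defs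
begin

text \<open>The embedded graph is itself a cellular decomposition of \<open>S\<close>, so \<open>chi = V - E + F\<close> for its
  numbers of vertices, edges and faces. Here \<open>V = p\<close>, and \<open>E = p (d + 1) / 2\<close> because every vertex
  has degree \<open>d + 1\<close>. A bi-colored cycle has as many edges as vertices, so
  giving each vertex the weight \<open>1 / l\<close> for each cycle of length \<open>l\<close> through it counts every cycle
  once; this is \<open>F = p * (\<Sum>i. 1 / l i)\<close> when the face lengths at each vertex are \<open>l 0, \<dots>, l d\<close>
  (\<open>euler_characteristic_formula\<close>). Hence
  \<open>chi = p * (1 - (d + 1) / 2 + (\<Sum>i. 1 / l i))\<close>.

  The topology enters only through this formula. If \<open>chi\<close> is positive, so is the bracket; as every
  \<open>l i\<close> is at least 4, this forces \<open>d = 2\<close>. What remains is to find the triples of even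
  numbers that are at least 4 and whose reciprocals have a sum exceeding \<open>1 / 2\<close>
  (\<open>even_triples_reciprocal_sum_gt_half\<close>; the lengths are even because the two colors alternate
  along a cycle), and to solve the formula for \<open>p\<close>.\<close>

section \<open>Edges at a vertex\<close>

lemma regular_colored_graphD:
  assumes "regular_colored_graph d \<Gamma>"
  shows "finite (verts \<Gamma>)" "finite (edges \<Gamma>)"
    and "\<And>e. e \<in> edges \<Gamma> \<Longrightarrow> ends \<Gamma> e \<subseteq> verts \<Gamma>"
    and "\<And>e. e \<in> edges \<Gamma> \<Longrightarrow> card (ends \<Gamma> e) = 2"
    and "\<And>v. v \<in> verts \<Gamma> \<Longrightarrow> card {e \<in> edges \<Gamma>. v \<in> ends \<Gamma> e} = d + 1"
    and "color \<Gamma> ` edges \<Gamma> = {..d}"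
    and "\<And>e f v. \<lbrakk>e \<in> edges \<Gamma>; f \<in> edges \<Gamma>; v \<in> ends \<Gamma> e; v \<in> ends \<Gamma> f;
           color \<Gamma> e = color \<Gamma> f\<rbrakk> \<Longrightarrow> e = f"
proof -
  note * = assms[unfolded regular_colored_graph_def]
  show "finite (verts \<Gamma>)" "finite (edges \<Gamma>)" "color \<Gamma> ` edges \<Gamma> = {..d}"
    using * by simp_all
  show "ends \<Gamma> e \<subseteq> verts \<Gamma>" "card (ends \<Gamma> e) = 2" if "e \<in> edges \<Gamma>" for e
    using * that by simp_all
  show "card {e \<in> edges \<Gamma>. v \<in> ends \<Gamma> e} = d + 1" if "v \<in> verts \<Gamma>" for v
    using * that by simp
  show "e = f" if "e \<in> edges \<Gamma>" "f \<in> edges \<Gamma>" "v \<in> ends \<Gamma> e" "v \<in> ends \<Gamma> f"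
    "color \<Gamma> e = color \<Gamma> f" for e f v
  proof (rule ccontr)
    assume "e \<noteq> f"
    moreover have "ends \<Gamma> e \<inter> ends \<Gamma> f \<noteq> {}" using that by blast
    ultimately show False using * that by simp
  qed
qed

text \<open>The \<open>d + 1\<close> edges at a vertex have distinct colors, and only \<open>d + 1\<close> colors exist.\<close>

lemma regular_colored_graph_unique_edge:
  assumes reg: "regular_colored_graph d \<Gamma>" and v: "v \<in> verts \<Gamma>" and c: "c \<le> d"
  shows "card {e \<in> edges \<Gamma>. color \<Gamma> e = c \<and> v \<in> ends \<Gamma> e} = 1"
proof -
  let ?St = "{e \<in> edges \<Gamma>. v \<in> ends \<Gamma> e}"
  have inj: "inj_on (color \<Gamma>) ?St"
    using regular_colored_graphD(7)[OF reg] by (intro inj_onI) blast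
  have "card ?St = d + 1"
    by (rule regular_colored_graphD(5)[OF reg v])
  hence "card (color \<Gamma> ` ?St) = card {..d}"
    using inj by (simp add: card_image)
  moreover have "color \<Gamma> ` ?St \<subseteq> {..d}"
    using regular_colored_graphD(6)[OF reg] by blast
  ultimately have "color \<Gamma> ` ?St = {..d}"
    by (intro card_subset_eq) auto
  then obtain e where e: "e \<in> ?St" "color \<Gamma> e = c"
    using c by (metis (no_types, lifting) atMost_iff imageE)
  have "{e \<in> edges \<Gamma>. color \<Gamma> e = c \<and> v \<in> ends \<Gamma> e} = {e}"
    using e inj unfolding inj_on_def by blast
  thus ?thesis by simp
qed

lemma regular_colored_graph_card_edges:
  assumes reg: "regular_colored_graph d \<Gamma>"
  shows "2 * card (edges \<Gamma>) = card (verts \<Gamma>) * (d + 1)"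
proof -
  have "(\<Sum>v\<in>verts \<Gamma>. card {e \<in> edges \<Gamma>. v \<in> ends \<Gamma> e}) = 2 * card (edges \<Gamma>)"
  proof (rule sum_multicount)
    show "\<forall>e\<in>edges \<Gamma>. card {v \<in> verts \<Gamma>. v \<in> ends \<Gamma> e} = 2"
    proof
      fix e assume "e \<in> edges \<Gamma>"
      hence "ends \<Gamma> e \<subseteq> verts \<Gamma>" "card (ends \<Gamma> e) = 2"
        using regular_colored_graphD[OF reg] by blast+
      moreover from this have "{v \<in> verts \<Gamma>. v \<in> ends \<Gamma> e} = ends \<Gamma> e" by blast
      ultimately show "card {v \<in> verts \<Gamma>. v \<in> ends \<Gamma> e} = 2" by simp
    qed
  qed (use regular_colored_graphD[OF reg] in auto)
  moreover have "(\<Sum>v\<in>verts \<Gamma>. card {e \<in> edges \<Gamma>. v \<in> ends \<Gamma> e}) = card (verts \<Gamma>) * (d + 1)"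
    using regular_colored_graphD(5)[OF reg] by simp
  ultimately show ?thesis by simp
qed

lemma regular_colored_graph_verts_nonempty:
  assumes reg: "regular_colored_graph d \<Gamma>"
  shows "verts \<Gamma> \<noteq> {}"
proof -
  have "0 \<in> color \<Gamma> ` edges \<Gamma>"
    using regular_colored_graphD(6)[OF reg] by simp
  then obtain e where "e \<in> edges \<Gamma>" by blast
  hence "ends \<Gamma> e \<subseteq> verts \<Gamma>" "card (ends \<Gamma> e) = 2"
    using regular_colored_graphD(1-4)[OF reg] by blast+
  thus ?thesis by auto
qed

section \<open>Lengths and numbers of bi-colored cycles\<close>

definition bicolored_component :: "('v, 'e) colored_graph \<Rightarrow> nat \<Rightarrow> nat \<Rightarrow> 'v \<Rightarrow> 'v set" where
  "bicolored_component \<Gamma> a b v = {u. (v, u) \<in> (bicolored_adj \<Gamma> a b)\<^sup>*}"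

lemma sym_bicolored_adj: "sym (bicolored_adj \<Gamma> a b)"
  unfolding bicolored_adj_def sym_def by (auto simp: insert_commute)

lemma bicolored_component_eq:
  assumes "w \<in> bicolored_component \<Gamma> a b v"
  shows "bicolored_component \<Gamma> a b w = bicolored_component \<Gamma> a b v"
proof -
  have vw: "(v, w) \<in> (bicolored_adj \<Gamma> a b)\<^sup>*"
    using assms by (simp add: bicolored_component_def)
  moreover have "(w, v) \<in> (bicolored_adj \<Gamma> a b)\<^sup>*"
    using vw sym_rtrancl[OF sym_bicolored_adj] by (metis symD)
  ultimately show ?thesis
    unfolding bicolored_component_def by (auto intro: rtrancl_trans)
qed

lemma bicolored_component_subset_verts:
  assumes reg: "regular_colored_graph d \<Gamma>" and v: "v \<in> verts \<Gamma>"
  shows "bicolored_component \<Gamma> a b v \<subseteq> verts \<Gamma>"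
proof
  fix u assume "u \<in> bicolored_component \<Gamma> a b v"
  hence "(v, u) \<in> (bicolored_adj \<Gamma> a b)\<^sup>*" by (simp add: bicolored_component_def)
  thus "u \<in> verts \<Gamma>"
  proof (induction rule: rtrancl_induct)
    case (step y z)
    then obtain e where "e \<in> edges \<Gamma>" "ends \<Gamma> e = {y, z}"
      unfolding bicolored_adj_def by blast
    thus ?case using regular_colored_graphD(1-4)[OF reg] by blast
  qed (rule v)
qed

lemma ends_subset_bicolored_component:
  assumes reg: "regular_colored_graph d \<Gamma>" and e: "e \<in> edges \<Gamma>" "color \<Gamma> e \<in> {a, b}"
    and u: "u \<in> ends \<Gamma> e" "u \<in> bicolored_component \<Gamma> a b v"
  shows "ends \<Gamma> e \<subseteq> bicolored_component \<Gamma> a b v"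
proof
  fix w assume w: "w \<in> ends \<Gamma> e"
  have "card (ends \<Gamma> e) = 2"
    using regular_colored_graphD(4)[OF reg e(1)] .
  then obtain x y where xy: "ends \<Gamma> e = {x, y}" by (auto simp: card_2_iff)
  show "w \<in> bicolored_component \<Gamma> a b v"
  proof (cases "w = u")
    case False
    hence "ends \<Gamma> e = {u, w}" using xy u w by auto
    hence "(u, w) \<in> bicolored_adj \<Gamma> a b" unfolding bicolored_adj_def using e by blast
    thus ?thesis using u unfolding bicolored_component_def
      by (auto intro: rtrancl.rtrancl_into_rtrancl)
  qed (use u in simp)
qed

lemma bicolored_cycle_alt:
  "bicolored_cycle \<Gamma> a b v =
    {e \<in> edges \<Gamma>. color \<Gamma> e \<in> {a, b} \<and> ends \<Gamma> e \<inter> bicolored_component \<Gamma> a b v \<noteq> {}}"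
  unfolding bicolored_cycle_def bicolored_component_def by blast

text \<open>The edges of one color are a perfect matching of the component. The cycle consists of two
  such matchings, so its length is even and equals the number of vertices of the component.\<close>

lemma card_color_class_bicolored_cycle:
  assumes reg: "regular_colored_graph d \<Gamma>" and v: "v \<in> verts \<Gamma>"
    and c: "c \<le> d" "c \<in> {a, b}"
  shows "2 * card {e \<in> bicolored_cycle \<Gamma> a b v. color \<Gamma> e = c} =
    card (bicolored_component \<Gamma> a b v)"
proof -
  let ?K = "bicolored_component \<Gamma> a b v"
  let ?T = "{e \<in> bicolored_cycle \<Gamma> a b v. color \<Gamma> e = c}"
  have KV: "?K \<subseteq> verts \<Gamma>" by (rule bicolored_component_subset_verts[OF reg v])
  have "(\<Sum>u\<in>?K. card {e \<in> ?T. u \<in> ends \<Gamma> e}) = 2 * card ?T"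
  proof (rule sum_multicount)
    show "finite ?K"
      using KV regular_colored_graphD(1)[OF reg] by (rule finite_subset)
    show "finite ?T"
      using regular_colored_graphD(2)[OF reg] unfolding bicolored_cycle_def by simp
    show "\<forall>e\<in>?T. card {u \<in> ?K. u \<in> ends \<Gamma> e} = 2"
    proof
      fix e assume "e \<in> ?T"
      then obtain u where e: "e \<in> edges \<Gamma>" "color \<Gamma> e \<in> {a, b}" and "u \<in> ends \<Gamma> e" "u \<in> ?K"
        unfolding bicolored_cycle_alt by blast
      hence "ends \<Gamma> e \<subseteq> ?K" by (rule ends_subset_bicolored_component[OF reg])
      hence "{u \<in> ?K. u \<in> ends \<Gamma> e} = ends \<Gamma> e" by blast
      thus "card {u \<in> ?K. u \<in> ends \<Gamma> e} = 2"
        using regular_colored_graphD(4)[OF reg e(1)] by simp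
    qed
  qed
  moreover have "card {e \<in> ?T. u \<in> ends \<Gamma> e} = 1" if "u \<in> ?K" for u
  proof -
    have "{e \<in> ?T. u \<in> ends \<Gamma> e} = {e \<in> edges \<Gamma>. color \<Gamma> e = c \<and> u \<in> ends \<Gamma> e}"
      using that c(2) unfolding bicolored_cycle_alt by blast
    thus ?thesis
      using regular_colored_graph_unique_edge[OF reg _ c(1)] that KV by auto
  qed
  ultimately show ?thesis by simp
qed

lemma card_bicolored_cycle:
  assumes reg: "regular_colored_graph d \<Gamma>" and v: "v \<in> verts \<Gamma>"
    and ab: "a \<le> d" "b \<le> d" "a \<noteq> b"
  shows "card (bicolored_cycle \<Gamma> a b v) = card (bicolored_component \<Gamma> a b v)"
    and "even (card (bicolored_cycle \<Gamma> a b v))"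
proof -
  let ?C = "bicolored_cycle \<Gamma> a b v"
  let ?T = "\<lambda>c. {e \<in> ?C. color \<Gamma> e = c}"
  have a: "2 * card (?T a) = card (bicolored_component \<Gamma> a b v)"
    and b: "2 * card (?T b) = card (bicolored_component \<Gamma> a b v)"
    using card_color_class_bicolored_cycle[OF reg v, of _ a b] ab by auto
  have fin: "finite ?C"
    using regular_colored_graphD(2)[OF reg] unfolding bicolored_cycle_def by simp
  have "?C = ?T a \<union> ?T b" unfolding bicolored_cycle_def by blast
  hence "card ?C = card (?T a \<union> ?T b)" by simp
  also have "\<dots> = card (?T a) + card (?T b)"
    by (rule card_Un_disjoint) (use fin ab in auto)
  finally have "card ?C = card (?T a) + card (?T b)" .
  with a b show "card ?C = card (bicolored_component \<Gamma> a b v)" "even (card ?C)"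
    by presburger+
qed

lemma bicolored_cycle_has_color:
  assumes reg: "regular_colored_graph d \<Gamma>" and v: "v \<in> verts \<Gamma>" and c: "c \<le> d" "c \<in> {a, b}"
  obtains e where "e \<in> bicolored_cycle \<Gamma> a b v" "color \<Gamma> e = c" "v \<in> ends \<Gamma> e"
proof -
  have "{e \<in> edges \<Gamma>. color \<Gamma> e = c \<and> v \<in> ends \<Gamma> e} \<noteq> {}"
    using regular_colored_graph_unique_edge[OF reg v c(1)] by force
  then obtain e where "e \<in> edges \<Gamma>" "color \<Gamma> e = c" "v \<in> ends \<Gamma> e" by blast
  thus thesis using that c(2) unfolding bicolored_cycle_def by blast
qed

lemma bicolored_cycle_eq_iff:
  assumes reg: "regular_colored_graph d \<Gamma>" and w: "w \<in> verts \<Gamma>" and a: "a \<le> d"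
  shows "bicolored_cycle \<Gamma> a b w = bicolored_cycle \<Gamma> a b v \<longleftrightarrow> w \<in> bicolored_component \<Gamma> a b v"
proof
  assume eq: "bicolored_cycle \<Gamma> a b w = bicolored_cycle \<Gamma> a b v"
  obtain e where e: "e \<in> bicolored_cycle \<Gamma> a b w" "w \<in> ends \<Gamma> e"
    using bicolored_cycle_has_color[OF reg w a, of a b] by blast
  then obtain u where "e \<in> edges \<Gamma>" "color \<Gamma> e \<in> {a, b}" "u \<in> ends \<Gamma> e"
      "u \<in> bicolored_component \<Gamma> a b v"
    unfolding eq unfolding bicolored_cycle_alt by blast
  thus "w \<in> bicolored_component \<Gamma> a b v"
    using ends_subset_bicolored_component[OF reg] e(2) by blast
qed (simp add: bicolored_cycle_alt bicolored_component_eq)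

text \<open>A cycle of length \<open>l\<close> receives \<open>1 / l\<close> from each of its \<open>l\<close> vertices.\<close>

lemma card_bicolored_cycles:
  assumes reg: "regular_colored_graph d \<Gamma>" and ab: "a \<le> d" "b \<le> d" "a \<noteq> b"
  shows "real (card (bicolored_cycle \<Gamma> a b ` verts \<Gamma>)) =
    (\<Sum>v\<in>verts \<Gamma>. 1 / real (card (bicolored_cycle \<Gamma> a b v)))"
proof -
  let ?f = "bicolored_cycle \<Gamma> a b"
  have fin: "finite (verts \<Gamma>)" using regular_colored_graphD(1-4)[OF reg] by blast
  have "(\<Sum>v\<in>verts \<Gamma>. 1 / real (card (?f v))) =
      (\<Sum>C\<in>?f ` verts \<Gamma>. \<Sum>v\<in>{v \<in> verts \<Gamma>. ?f v = C}. 1 / real (card (?f v)))"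
    by (rule sum.image_gen[OF fin])
  also have "\<dots> = (\<Sum>C\<in>?f ` verts \<Gamma>. 1)"
  proof (rule sum.cong[OF refl])
    fix C assume "C \<in> ?f ` verts \<Gamma>"
    then obtain w where w: "w \<in> verts \<Gamma>" "C = ?f w" by blast
    have "{v \<in> verts \<Gamma>. ?f v = C} = bicolored_component \<Gamma> a b w"
      using bicolored_cycle_eq_iff[OF reg _ ab(1)] bicolored_component_subset_verts[OF reg w(1)] w(2)
      by blast
    hence K: "card {v \<in> verts \<Gamma>. ?f v = C} = card C"
      using card_bicolored_cycle(1)[OF reg w(1) ab] w(2) by simp
    have "w \<in> {v \<in> verts \<Gamma>. ?f v = C}" using w by simp
    hence "card {v \<in> verts \<Gamma>. ?f v = C} \<noteq> 0" using fin by auto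
    hence "card C \<noteq> 0" using K by simp
    have "(\<Sum>v\<in>{v \<in> verts \<Gamma>. ?f v = C}. 1 / real (card (?f v))) =
        (\<Sum>v\<in>{v \<in> verts \<Gamma>. ?f v = C}. 1 / real (card C))"
      by (rule sum.cong) auto
    also have "\<dots> = 1" using K \<open>card C \<noteq> 0\<close> by simp
    finally show "(\<Sum>v\<in>{v \<in> verts \<Gamma>. ?f v = C}. 1 / real (card (?f v))) = 1" .
  qed
  finally show ?thesis by simp
qed

section \<open>The bounding cycles of a color arrangement\<close>

lemma color_arrangement_consecutive:
  assumes "color_arrangement d \<epsilon>" "d \<ge> 1" "i \<le> d"
  shows "\<epsilon> i \<le> d" "\<epsilon> ((i + 1) mod (d + 1)) \<le> d" "\<epsilon> i \<noteq> \<epsilon> ((i + 1) mod (d + 1))"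
proof -
  have inj: "inj_on \<epsilon> {..d}" and im: "\<epsilon> ` {..d} = {..d}"
    using assms(1) unfolding color_arrangement_def bij_betw_def by auto
  have i': "(i + 1) mod (d + 1) \<le> d"
    using mod_less_divisor[of "d + 1" "i + 1"] by linarith
  have ne: "i \<noteq> (i + 1) mod (d + 1)"
    using assms by (cases "i = d") auto
  show "\<epsilon> i \<le> d" "\<epsilon> ((i + 1) mod (d + 1)) \<le> d"
    using im assms(3) i' by (metis atMost_iff imageI)+
  show "\<epsilon> i \<noteq> \<epsilon> ((i + 1) mod (d + 1))"
    using inj_onD[OF inj] assms(3) i' ne by (metis atMost_iff)
qed

text \<open>A cycle determines its two colors, and with at least three colors in the cyclic order a pair
  of consecutive colors determines its position. So no cycle is counted for two positions.\<close>

lemma face_cycle_at_index_unique: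
  assumes reg: "regular_colored_graph d \<Gamma>" and arr: "color_arrangement d \<epsilon>" and d: "d \<ge> 2"
    and ij: "i \<le> d" "j \<le> d" and uv: "u \<in> verts \<Gamma>" "v \<in> verts \<Gamma>"
    and eq: "face_cycle_at d \<Gamma> \<epsilon> i u = face_cycle_at d \<Gamma> \<epsilon> j v"
  shows "i = j"
proof (rule ccontr)
  assume "i \<noteq> j"
  have colors: "color \<Gamma> ` face_cycle_at d \<Gamma> \<epsilon> k w = {\<epsilon> k, \<epsilon> ((k + 1) mod (d + 1))}"
    if "k \<le> d" "w \<in> verts \<Gamma>" for k w
  proof
    show "color \<Gamma> ` face_cycle_at d \<Gamma> \<epsilon> k w \<subseteq> {\<epsilon> k, \<epsilon> ((k + 1) mod (d + 1))}"
      unfolding face_cycle_at_def bicolored_cycle_def by blast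
    show "{\<epsilon> k, \<epsilon> ((k + 1) mod (d + 1))} \<subseteq> color \<Gamma> ` face_cycle_at d \<Gamma> \<epsilon> k w"
      unfolding face_cycle_at_def
      using bicolored_cycle_has_color[OF reg that(2)] color_arrangement_consecutive[OF arr _ that(1)] d
      by (smt (verit) image_eqI insert_iff one_le_numeral order_trans singletonD subsetI)
  qed
  have inj: "inj_on \<epsilon> {..d}"
    using arr unfolding color_arrangement_def bij_betw_def by auto
  have lt: "(k + 1) mod (d + 1) \<le> d" for k
    using mod_less_divisor[of "d + 1" "k + 1"] by linarith
  have "\<epsilon> ` {i, (i + 1) mod (d + 1)} = \<epsilon> ` {j, (j + 1) mod (d + 1)}"
    using colors[OF ij(1) uv(1)] colors[OF ij(2) uv(2)] eq by auto
  moreover have "{i, (i + 1) mod (d + 1)} \<subseteq> {..d}" "{j, (j + 1) mod (d + 1)} \<subseteq> {..d}"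
    using ij lt[of i] lt[of j] by simp_all
  ultimately have "{i, (i + 1) mod (d + 1)} = {j, (j + 1) mod (d + 1)}"
    using inj_on_image_eq_iff[OF inj] by blast
  hence "i = (j + 1) mod (d + 1)" "j = (i + 1) mod (d + 1)"
    using \<open>i \<noteq> j\<close> unfolding doubleton_eq_iff by metis+
  moreover have "(k + 1) mod (d + 1) = (if k = d then 0 else k + 1)" if "k \<le> d" for k
    using that by simp
  ultimately have "i = (if j = d then 0 else j + 1)" "j = (if i = d then 0 else i + 1)"
    using ij by metis+
  thus False using d by presburger
qed

lemma card_bounding_cycles:
  assumes reg: "regular_colored_graph d \<Gamma>" and arr: "color_arrangement d \<epsilon>" and d: "d \<ge> 2"
  shows "real (card (bounding_cycles d \<Gamma> \<epsilon>)) =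
    (\<Sum>v\<in>verts \<Gamma>. \<Sum>l\<leftarrow>face_lengths d \<Gamma> \<epsilon> v. 1 / real l)"
proof -
  let ?f = "face_cycle_at d \<Gamma> \<epsilon>"
  have fin: "finite (verts \<Gamma>)" using regular_colored_graphD(1-4)[OF reg] by blast
  have "bounding_cycles d \<Gamma> \<epsilon> = (\<Union>i\<in>{..d}. ?f i ` verts \<Gamma>)"
    unfolding bounding_cycles_def by auto
  hence "card (bounding_cycles d \<Gamma> \<epsilon>) = card (\<Union>i\<in>{..d}. ?f i ` verts \<Gamma>)" by simp
  also have "\<dots> = (\<Sum>i\<le>d. card (?f i ` verts \<Gamma>))"
    by (rule card_UN_disjoint)
      (use fin face_cycle_at_index_unique[OF reg arr d] in \<open>auto 0 4\<close>)
  finally have "real (card (bounding_cycles d \<Gamma> \<epsilon>)) = (\<Sum>i\<le>d. real (card (?f i ` verts \<Gamma>)))"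
    by simp
  also have "\<dots> = (\<Sum>i\<le>d. \<Sum>v\<in>verts \<Gamma>. 1 / real (card (?f i v)))"
    unfolding face_cycle_at_def
    by (intro sum.cong refl card_bicolored_cycles[OF reg] color_arrangement_consecutive[OF arr])
      (use d in auto)
  also have "\<dots> = (\<Sum>v\<in>verts \<Gamma>. \<Sum>i\<le>d. 1 / real (card (?f i v)))"
    by (rule sum.swap)
  also have "\<dots> = (\<Sum>v\<in>verts \<Gamma>. \<Sum>l\<leftarrow>face_lengths d \<Gamma> \<epsilon> v. 1 / real l)"
    unfolding face_lengths_def
    by (simp add: o_def sum_list_distinct_conv_sum_set atLeast0LessThan flip: lessThan_Suc_atMost)
  finally show ?thesis .
qed

lemma set_face_lengths:
  "set (face_lengths d \<Gamma> \<epsilon> v) = {card (face_cycle_at d \<Gamma> \<epsilon> i v) | i. i \<le> d}"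
proof -
  have "set [0..<d + 1] = {..d}" unfolding set_upt by (simp add: atLeast0LessThan lessThan_Suc_atMost)
  hence "set (face_lengths d \<Gamma> \<epsilon> v) = (\<lambda>i. card (face_cycle_at d \<Gamma> \<epsilon> i v)) ` {..d}"
    unfolding face_lengths_def set_map by (rule arg_cong)
  thus ?thesis unfolding setcompr_eq_image atMost_def .
qed

lemma face_lengths_even:
  assumes reg: "regular_colored_graph d \<Gamma>" and arr: "color_arrangement d \<epsilon>" and d: "d \<ge> 1"
    and v: "v \<in> verts \<Gamma>" and l: "l \<in> set (face_lengths d \<Gamma> \<epsilon> v)"
  shows "even l"
proof -
  obtain i where i: "i \<le> d" and l: "l = card (face_cycle_at d \<Gamma> \<epsilon> i v)"
    using l unfolding set_face_lengths by blast
  show ?thesis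
    unfolding l face_cycle_at_def
    by (intro card_bicolored_cycle(2)[OF reg v] color_arrangement_consecutive[OF arr d i])
qed

section \<open>The Euler characteristic of a regular embedding\<close>

lemma graph_embeddingD:
  assumes "graph_embedding \<Gamma> S \<phi> \<alpha>"
  shows "inj_on \<phi> (verts \<Gamma>)" "\<phi> ` verts \<Gamma> \<subseteq> topspace S"
    and "\<And>e. e \<in> edges \<Gamma> \<Longrightarrow> pathin S (\<alpha> e)"
    and "\<And>e. e \<in> edges \<Gamma> \<Longrightarrow> inj_on (\<alpha> e) {0..1}"
    and "\<And>e. e \<in> edges \<Gamma> \<Longrightarrow> {\<alpha> e 0, \<alpha> e 1} = \<phi> ` ends \<Gamma> e"
    and "\<And>e. e \<in> edges \<Gamma> \<Longrightarrow> \<alpha> e ` {0<..<1} \<inter> \<phi> ` verts \<Gamma> = {}"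
    and "\<And>e f. \<lbrakk>e \<in> edges \<Gamma>; f \<in> edges \<Gamma>; e \<noteq> f\<rbrakk> \<Longrightarrow> \<alpha> e ` {0<..<1} \<inter> \<alpha> f ` {0<..<1} = {}"
  using assms unfolding graph_embedding_def by (elim conjE; simp)+

lemma open_arc_meets_closed_arc:
  assumes reg: "regular_colored_graph d \<Gamma>" and emb: "graph_embedding \<Gamma> S \<phi> \<alpha>"
    and ef: "e \<in> edges \<Gamma>" "f \<in> edges \<Gamma>"
    and st: "s \<in> {0<..<1}" "t \<in> {0..1}" "\<alpha> e s = \<alpha> f t"
  shows "e = f"
proof -
  have s: "\<alpha> e s \<in> \<alpha> e ` {0<..<1}" using st by blast
  have "\<alpha> f 0 \<in> \<phi> ` ends \<Gamma> f" "\<alpha> f 1 \<in> \<phi> ` ends \<Gamma> f"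
    using graph_embeddingD(5)[OF emb ef(2)] by blast+
  moreover have "ends \<Gamma> f \<subseteq> verts \<Gamma>"
    using regular_colored_graphD(3)[OF reg] ef by blast
  moreover have "\<alpha> e s \<notin> \<phi> ` verts \<Gamma>"
    using graph_embeddingD(6)[OF emb ef(1)] s by blast
  ultimately have "t \<noteq> 0" "t \<noteq> 1" using st by auto
  hence "\<alpha> e s \<in> \<alpha> f ` {0<..<1}" using st by simp
  thus "e = f" using graph_embeddingD(7)[OF emb ef] s by blast
qed

text \<open>The midpoint of an arc lies on no other arc, so a union of arcs tells which edges it
  consists of. Hence, in a regular embedding, distinct bounding cycles bound distinct faces, and
  there are as many faces as bounding cycles.\<close>

lemma inj_on_image_of_edges:
  assumes reg: "regular_colored_graph d \<Gamma>" and emb: "graph_embedding \<Gamma> S \<phi> \<alpha>"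
  shows "inj_on (image_of_edges \<alpha>) (Pow (edges \<Gamma>))"
proof -
  have mid: "e \<in> C \<longleftrightarrow> \<alpha> e (1/2) \<in> image_of_edges \<alpha> C" if "e \<in> edges \<Gamma>" "C \<subseteq> edges \<Gamma>" for e C
  proof
    assume "e \<in> C"
    thus "\<alpha> e (1/2) \<in> image_of_edges \<alpha> C" unfolding image_of_edges_def by force
  next
    assume "\<alpha> e (1/2) \<in> image_of_edges \<alpha> C"
    then obtain f t where "f \<in> C" "t \<in> {0..1}" "\<alpha> e (1/2) = \<alpha> f t"
      unfolding image_of_edges_def by blast
    thus "e \<in> C"
      using open_arc_meets_closed_arc[OF reg emb, of e f "1/2" t] that by auto
  qed
  show ?thesis
  proof (rule inj_onI)
    fix C D assume CD: "C \<in> Pow (edges \<Gamma>)" "D \<in> Pow (edges \<Gamma>)"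
      "image_of_edges \<alpha> C = image_of_edges \<alpha> D"
    have "e \<in> C \<longleftrightarrow> e \<in> D" if "e \<in> edges \<Gamma>" for e
      using mid[OF that, of C] mid[OF that, of D] CD by simp
    thus "C = D" using CD by blast
  qed
qed

lemma image_of_all_edges:
  assumes reg: "regular_colored_graph d \<Gamma>" and emb: "graph_embedding \<Gamma> S \<phi> \<alpha>"
  shows "image_of_edges \<alpha> (edges \<Gamma>) = \<phi> ` verts \<Gamma> \<union> (\<Union>e\<in>edges \<Gamma>. \<alpha> e ` {0<..<1})"
proof -
  have arc: "\<alpha> e ` {0..1} = \<phi> ` ends \<Gamma> e \<union> \<alpha> e ` {0<..<1}" if "e \<in> edges \<Gamma>" for e
  proof -
    have "{0..1::real} = {0, 1} \<union> {0<..<1}" by auto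
    hence "\<alpha> e ` {0..1} = {\<alpha> e 0, \<alpha> e 1} \<union> \<alpha> e ` {0<..<1}" by (simp only: image_Un) simp
    thus ?thesis using graph_embeddingD(5)[OF emb that] by simp
  qed
  have "(\<Union>e\<in>edges \<Gamma>. ends \<Gamma> e) = verts \<Gamma>"
  proof
    show "(\<Union>e\<in>edges \<Gamma>. ends \<Gamma> e) \<subseteq> verts \<Gamma>"
      using regular_colored_graphD(1-4)[OF reg] by blast
    show "verts \<Gamma> \<subseteq> (\<Union>e\<in>edges \<Gamma>. ends \<Gamma> e)"
    proof
      fix v assume "v \<in> verts \<Gamma>"
      \<comment> \<open>The edge of color 0 at \<open>v\<close> serves as witness that \<open>v\<close> is not isolated.\<close>
      thus "v \<in> (\<Union>e\<in>edges \<Gamma>. ends \<Gamma> e)"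
        using bicolored_cycle_has_color[OF reg, of v 0 0 0] unfolding bicolored_cycle_def by blast
    qed
  qed
  hence "\<phi> ` verts \<Gamma> = (\<Union>e\<in>edges \<Gamma>. \<phi> ` ends \<Gamma> e)" by blast
  thus ?thesis unfolding image_of_edges_def using arc by auto
qed

lemma cellular_decomposition_of_regular_embedding:
  assumes reg: "regular_colored_graph d \<Gamma>" and emb: "regular_embedding d \<Gamma> \<epsilon> S \<phi> \<alpha>"
  shows "cellular_decomposition S (\<phi> ` verts \<Gamma>) ((\<lambda>e. \<alpha> e ` {0<..<1}) ` edges \<Gamma>)"
proof -
  have ge: "graph_embedding \<Gamma> S \<phi> \<alpha>"
    and disc: "\<forall>F\<in>faces S (image_of_edges \<alpha> (edges \<Gamma>)). open_disc S F"
    using emb unfolding regular_embedding_def Let_def by auto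
  have fin: "finite (verts \<Gamma>)" "finite (edges \<Gamma>)"
    using regular_colored_graphD(1-4)[OF reg] by blast+
  have arcs: "\<alpha> e ` {0<..<1} \<inter> \<phi> ` verts \<Gamma> = {} \<and>
      (\<exists>g. pathin S g \<and> g 0 \<in> \<phi> ` verts \<Gamma> \<and> g 1 \<in> \<phi> ` verts \<Gamma> \<and> inj_on g {0<..<1} \<and>
        \<alpha> e ` {0<..<1} = g ` {0<..<1})" if e: "e \<in> edges \<Gamma>" for e
  proof (intro conjI exI[of _ "\<alpha> e"])
    have "ends \<Gamma> e \<subseteq> verts \<Gamma>" using regular_colored_graphD(3)[OF reg] e by blast
    thus "\<alpha> e 0 \<in> \<phi> ` verts \<Gamma>" "\<alpha> e 1 \<in> \<phi> ` verts \<Gamma>"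
      using graph_embeddingD(5)[OF ge e] by blast+
    show "inj_on (\<alpha> e) {0<..<1}" by (rule inj_on_subset[OF graph_embeddingD(4)[OF ge e]]) auto
  qed (use graph_embeddingD[OF ge] e in simp_all)
  have "pairwise disjnt ((\<lambda>e. \<alpha> e ` {0<..<1}) ` edges \<Gamma>)"
  proof (rule pairwise_imageI)
    fix e f assume "e \<in> edges \<Gamma>" "f \<in> edges \<Gamma>" "e \<noteq> f"
    thus "disjnt (\<alpha> e ` {0<..<1}) (\<alpha> f ` {0<..<1})"
      unfolding disjnt_def by (rule graph_embeddingD(7)[OF ge])
  qed
  moreover have "\<phi> ` verts \<Gamma> \<subseteq> topspace S"
    by (rule graph_embeddingD(2)[OF ge])
  ultimately show ?thesis
    unfolding cellular_decomposition_def
    using fin arcs disc image_of_all_edges[OF reg ge] by (simp add: ball_simps)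
qed

text \<open>The summand is the combinatorial curvature at the vertex \<open>v\<close>, and the formula is the discrete
  Gauss-Bonnet theorem for the embedding.\<close>

lemma euler_characteristic_gauss_bonnet:
  assumes d: "d \<ge> 2" and reg: "regular_colored_graph d \<Gamma>"
    and emb: "regular_embedding d \<Gamma> \<epsilon> S \<phi> \<alpha>" and chi: "has_euler_characteristic S chi"
  shows "real_of_int chi =
    (\<Sum>v\<in>verts \<Gamma>. 1 - (real d + 1) / 2 + (\<Sum>l\<leftarrow>face_lengths d \<Gamma> \<epsilon> v. 1 / real l))"
proof -
  let ?arc = "\<lambda>e. \<alpha> e ` {0<..<1}"
  have ge: "graph_embedding \<Gamma> S \<phi> \<alpha>" and arr: "color_arrangement d \<epsilon>"
    and bij: "bij_betw (\<lambda>F. S frontier_of F) (faces S (image_of_edges \<alpha> (edges \<Gamma>)))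
        (image_of_edges \<alpha> ` bounding_cycles d \<Gamma> \<epsilon>)"
    using emb unfolding regular_embedding_def Let_def by auto
  have "bounding_cycles d \<Gamma> \<epsilon> \<subseteq> Pow (edges \<Gamma>)"
    unfolding bounding_cycles_def face_cycle_at_def bicolored_cycle_def by blast
  hence "inj_on (image_of_edges \<alpha>) (bounding_cycles d \<Gamma> \<epsilon>)"
    by (rule inj_on_subset[OF inj_on_image_of_edges[OF reg ge]])
  hence F: "card (faces S (image_of_edges \<alpha> (edges \<Gamma>))) = card (bounding_cycles d \<Gamma> \<epsilon>)"
    using bij_betw_same_card[OF bij] by (simp add: card_image)
  have V: "card (\<phi> ` verts \<Gamma>) = card (verts \<Gamma>)"
    by (rule card_image[OF graph_embeddingD(1)[OF ge]])
  have "inj_on ?arc (edges \<Gamma>)"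
  proof (rule inj_onI)
    fix e f assume ef: "e \<in> edges \<Gamma>" "f \<in> edges \<Gamma>" "?arc e = ?arc f"
    moreover have "?arc e \<noteq> {}" by simp
    ultimately show "e = f" using graph_embeddingD(7)[OF ge ef(1,2)] by auto
  qed
  hence E: "card (?arc ` edges \<Gamma>) = card (edges \<Gamma>)" by (rule card_image)
  have "int (card (\<phi> ` verts \<Gamma>)) - int (card (?arc ` edges \<Gamma>)) +
      int (card (faces S (\<phi> ` verts \<Gamma> \<union> \<Union>(?arc ` edges \<Gamma>)))) = chi"
    using chi cellular_decomposition_of_regular_embedding[OF reg emb]
    unfolding has_euler_characteristic_def by blast
  hence "int (card (verts \<Gamma>)) - int (card (edges \<Gamma>)) + int (card (bounding_cycles d \<Gamma> \<epsilon>)) = chi"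
    using E V F image_of_all_edges[OF reg ge] by simp
  hence "real_of_int chi =
      real (card (verts \<Gamma>)) - real (card (edges \<Gamma>)) + real (card (bounding_cycles d \<Gamma> \<epsilon>))"
    by (metis of_int_add of_int_diff of_int_of_nat_eq)
  moreover have "real (card (edges \<Gamma>)) = real (card (verts \<Gamma>)) * ((real d + 1) / 2)"
    using arg_cong[OF regular_colored_graph_card_edges[OF reg], of real] by (simp add: algebra_simps)
  ultimately show ?thesis
    using card_bounding_cycles[OF reg arr d]
    by (simp add: sum.distrib sum_subtractf algebra_simps)
qed

section \<open>Face-cycle types\<close>

lemma same_type_imp_mset_eq:
  assumes "same_type xs ys"
  shows "mset xs = mset ys"
proof -
  have "mset (rotate1 zs) = mset zs" for zs :: "nat list" by (cases zs) auto
  hence "mset (rotate n zs) = mset zs" for n and zs :: "nat list" by (induction n) simp_all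
  thus ?thesis using assms unfolding same_type_def by auto
qed

lemma list_of_length_3: "length xs = 3 \<Longrightarrow> \<exists>a b c. xs = [a, b, c]"
  by (auto simp: length_Suc_conv eval_nat_numeral)

text \<open>Rotations and reflections of a triangle realize all permutations of its corners, so for three
  faces at a vertex the multiset of face lengths already determines the type.\<close>

lemma same_type_length_3:
  assumes "length xs = 3" "mset xs = mset ys"
  shows "same_type xs ys"
proof -
  obtain a b c where xs: "xs = [a, b, c]"
    using list_of_length_3[OF assms(1)] by blast
  have "length ys = 3" using assms by (metis size_mset)
  then obtain x y z where ys: "ys = [x, y, z]"
    using list_of_length_3 by blast
  have "ys = rotate 0 xs \<or> ys = rotate 1 xs \<or> ys = rotate 2 xs \<or>
      ys = rotate 0 (rev xs) \<or> ys = rotate 1 (rev xs) \<or> ys = rotate 2 (rev xs)"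
    using assms(2) unfolding xs ys
    by (auto simp: eval_nat_numeral add_eq_conv_ex)
  thus ?thesis unfolding same_type_def by blast
qed

lemma same_type_sum_list_eq:
  fixes f :: "nat \<Rightarrow> real"
  assumes "same_type xs ys"
  shows "(\<Sum>l\<leftarrow>xs. f l) = (\<Sum>l\<leftarrow>ys. f l)"
proof -
  have "mset (map f xs) = mset (map f ys)"
    using same_type_imp_mset_eq[OF assms] by simp
  thus ?thesis by (metis sum_mset_sum_list)
qed

lemma euler_characteristic_formula:
  assumes d: "d \<ge> 2" and reg: "regular_colored_graph d \<Gamma>"
    and emb: "regular_embedding d \<Gamma> \<epsilon> S \<phi> \<alpha>" and chi: "has_euler_characteristic S chi"
    and type: "embedding_type d \<Gamma> \<epsilon> t"
  shows "real_of_int chi =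
    real (card (verts \<Gamma>)) * (1 - (real d + 1) / 2 + (\<Sum>l\<leftarrow>t. 1 / real l))"
proof -
  have "(\<Sum>l\<leftarrow>face_lengths d \<Gamma> \<epsilon> v. 1 / real l) = (\<Sum>l\<leftarrow>t. 1 / real l)" if "v \<in> verts \<Gamma>" for v
    using type that unfolding embedding_type_def by (intro same_type_sum_list_eq) blast
  thus ?thesis
    using euler_characteristic_gauss_bonnet[OF d reg emb chi] by simp
qed

lemma sum_list_reciprocals_le:
  assumes "\<forall>l\<in>set xs. 4 \<le> l"
  shows "(\<Sum>l\<leftarrow>xs. 1 / real l) \<le> real (length xs) / 4"
  using assms
proof (induction xs)
  case (Cons l xs)
  have "1 / real l \<le> 1 / 4" using Cons.prems by (intro frac_le) auto
  moreover have "(\<Sum>l\<leftarrow>xs. 1 / real l) \<le> real (length xs) / 4" using Cons by simp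
  ultimately show ?case by (simp add: add_divide_distrib)
qed simp

text \<open>In increasing order, the first number is below 6, the second below 8 and, unless both
  are 4, the third below 12, since \<open>1/6 + 1/6 + 1/6\<close>, \<open>1/4 + 1/8 + 1/8\<close> and
  \<open>1/4 + 1/6 + 1/12\<close> are all equal to \<open>1/2\<close>.\<close>

lemma even_triples_reciprocal_sum_gt_half_sorted:
  fixes a b c :: nat
  assumes ev: "even a" "even b" "even c" and ge: "4 \<le> a" "a \<le> b" "b \<le> c"
    and sum: "1 / real a + 1 / real b + 1 / real c > 1 / 2"
  shows "a = 4 \<and> (b = 4 \<or> b = 6 \<and> c \<in> {6, 8, 10})"
proof -
  have le: "1 / real n \<le> 1 / x" if "x \<le> real n" "0 < x" for n :: nat and x :: real
    using that by (intro frac_le) auto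
  have "a < 6"
  proof (rule ccontr)
    assume "\<not> a < 6"
    hence "1 / real a \<le> 1 / 6" "1 / real b \<le> 1 / 6" "1 / real c \<le> 1 / 6"
      using ge by (auto intro!: le)
    thus False using sum by linarith
  qed
  hence a: "a = 4" using ev ge by presburger
  have "b < 8"
  proof (rule ccontr)
    assume "\<not> b < 8"
    hence "1 / real b \<le> 1 / 8" "1 / real c \<le> 1 / 8"
      using ge by (auto intro!: le)
    moreover have "1 / real a = 1 / 4" using a by simp
    ultimately show False using sum by linarith
  qed
  hence b: "b = 4 \<or> b = 6" using ev ge a by presburger
  moreover have "c \<in> {6, 8, 10}" if "b = 6"
  proof -
    have "c < 12"
    proof (rule ccontr)
      assume "\<not> c < 12"
      hence "1 / real c \<le> 1 / 12" by (auto intro!: le)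
      moreover have "1 / real a = 1 / 4" "1 / real b = 1 / 6" using a that by simp_all
      ultimately show False using sum by linarith
    qed
    moreover have "6 \<le> c" using ge that by simp
    ultimately have "c = 6 \<or> c = 8 \<or> c = 10" using ev by presburger
    thus ?thesis by simp
  qed
  ultimately show ?thesis using a by blast
qed

lemma even_triples_reciprocal_sum_gt_half:
  fixes xs :: "nat list"
  assumes len: "length xs = 3" and xs: "\<forall>l\<in>set xs. even l \<and> 4 \<le> l"
    and sum: "(\<Sum>l\<leftarrow>xs. 1 / real l) > 1 / 2"
  shows "mset xs \<in> mset ` {[4, 6, 8], [4, 6, 10], [6, 6, 4]} \<or>
    (\<exists>q\<ge>4. even q \<and> mset xs = mset [4, 4, q])"
proof -
  obtain a b c where abc: "sort xs = [a, b, c]"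
    using list_of_length_3[of "sort xs"] len by auto
  have m: "mset xs = mset [a, b, c]" by (metis abc mset_sort)
  have "set xs = {a, b, c}" using abc by (metis set_sort list.set(1,2))
  hence all: "even a" "even b" "even c" "4 \<le> a" "4 \<le> c" using xs by auto
  have "sorted [a, b, c]" unfolding abc[symmetric] by simp
  hence "a \<le> b" "b \<le> c" by auto
  moreover have "1 / real a + 1 / real b + 1 / real c > 1 / 2"
  proof -
    have "mset (map (\<lambda>l. 1 / real l) xs) = mset (map (\<lambda>l. 1 / real l) [a, b, c])"
      using m by simp
    hence "(\<Sum>l\<leftarrow>xs. 1 / real l) = (\<Sum>l\<leftarrow>[a, b, c]. 1 / real l)" by (metis sum_mset_sum_list)
    thus ?thesis using sum by simp
  qed
  ultimately have "a = 4 \<and> (b = 4 \<or> b = 6 \<and> c \<in> {6, 8, 10})"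
    using even_triples_reciprocal_sum_gt_half_sorted all by blast
  thus ?thesis using m all by (auto simp: add_mset_commute)
qed

theorem lemma4:
  fixes \<Gamma> :: "('v, 'e) colored_graph"
    and d p :: nat
    and M :: "'m::euclidean_space set"
    and \<epsilon> :: "nat \<Rightarrow> nat"
    and S :: "'s topology"
    and chi :: int
  assumes "d \<ge> 2"
    and "semi_equivelar_gem d \<Gamma> M \<epsilon> S"
    and "card (verts \<Gamma>) = p"
    and "has_euler_characteristic S chi"
    and "chi \<ge> 1"
  shows "(embedding_type d \<Gamma> \<epsilon> [4, 4, 4] \<or>
          embedding_type d \<Gamma> \<epsilon> [4, 6, 8] \<or>
          embedding_type d \<Gamma> \<epsilon> [4, 6, 10] \<or>
          embedding_type d \<Gamma> \<epsilon> [6, 6, 4] \<or>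
          (\<exists>q\<ge>4. even q \<and> embedding_type d \<Gamma> \<epsilon> [4, 4, q])) \<and>
         (chi = 1 \<longrightarrow>
            (embedding_type d \<Gamma> \<epsilon> [4, 4, 4] \<longrightarrow> p = 4) \<and>
            (embedding_type d \<Gamma> \<epsilon> [4, 6, 8] \<longrightarrow> p = 24) \<and>
            (embedding_type d \<Gamma> \<epsilon> [4, 6, 10] \<longrightarrow> p = 60) \<and>
            (embedding_type d \<Gamma> \<epsilon> [6, 6, 4] \<longrightarrow> p = 12) \<and>
            (\<forall>q\<ge>4. even q \<and> embedding_type d \<Gamma> \<epsilon> [4, 4, q] \<longrightarrow> p = q)) \<and>
         (chi = 2 \<longrightarrow>
            (embedding_type d \<Gamma> \<epsilon> [4, 4, 4] \<longrightarrow> p = 8) \<and>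
            (embedding_type d \<Gamma> \<epsilon> [4, 6, 8] \<longrightarrow> p = 48) \<and>
            (embedding_type d \<Gamma> \<epsilon> [4, 6, 10] \<longrightarrow> p = 120) \<and>
            (embedding_type d \<Gamma> \<epsilon> [6, 6, 4] \<longrightarrow> p = 24) \<and>
            (\<forall>q\<ge>4. even q \<and> embedding_type d \<Gamma> \<epsilon> [4, 4, q] \<longrightarrow> p = 2 * q))"
proof -
  obtain \<phi> \<alpha> where reg: "regular_colored_graph d \<Gamma>" and emb: "regular_embedding d \<Gamma> \<epsilon> S \<phi> \<alpha>"
    and ge4: "\<forall>C\<in>bounding_cycles d \<Gamma> \<epsilon>. 4 \<le> card C"
    and same: "\<forall>u\<in>verts \<Gamma>. \<forall>v\<in>verts \<Gamma>. same_type (face_lengths d \<Gamma> \<epsilon> u) (face_lengths d \<Gamma> \<epsilon> v)"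
    using assms(2) unfolding semi_equivelar_gem_def gem_of_def by blast
  have arr: "color_arrangement d \<epsilon>" using emb unfolding regular_embedding_def by blast
  obtain v where v: "v \<in> verts \<Gamma>" using regular_colored_graph_verts_nonempty[OF reg] by blast
  let ?L = "face_lengths d \<Gamma> \<epsilon> v"
  have type: "embedding_type d \<Gamma> \<epsilon> ?L" using same v unfolding embedding_type_def by blast
  have len: "length ?L = d + 1" unfolding face_lengths_def by simp
  have L4: "\<forall>l\<in>set ?L. 4 \<le> l"
  proof
    fix l assume "l \<in> set ?L"
    then obtain i where "i \<le> d" "l = card (face_cycle_at d \<Gamma> \<epsilon> i v)"
      unfolding set_face_lengths by blast
    thus "4 \<le> l" using ge4 v unfolding bounding_cycles_def by blast
  qed
  have formula: "real_of_int chi = real p * (1 - (real d + 1) / 2 + (\<Sum>l\<leftarrow>t. 1 / real l))"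
    if "embedding_type d \<Gamma> \<epsilon> t" for t
    using euler_characteristic_formula[OF assms(1) reg emb assms(4) that] assms(3) by simp
  have "0 < real p * (1 - (real d + 1) / 2 + (\<Sum>l\<leftarrow>?L. 1 / real l))"
    using formula[OF type] assms(5) by simp
  hence curv: "0 < 1 - (real d + 1) / 2 + (\<Sum>l\<leftarrow>?L. 1 / real l)"
    by (simp add: zero_less_mult_iff)
  define s where "s = (\<Sum>l\<leftarrow>?L. 1 / real l)"
  have "s \<le> (real d + 1) / 4"
    unfolding s_def using sum_list_reciprocals_le[OF L4] len by (simp add: add.commute)
  with curv[folded s_def] have "real d < 3" by (simp add: field_simps)
  hence d: "d = 2" using assms(1) by simp
  have sum: "(\<Sum>l\<leftarrow>?L. 1 / real l) > 1 / 2" using curv unfolding d by simp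
  have len3: "length (face_lengths d \<Gamma> \<epsilon> w) = 3" for w
    unfolding face_lengths_def d by simp
  have typeI: "embedding_type d \<Gamma> \<epsilon> t" if "mset ?L = mset t" for t
    unfolding embedding_type_def
  proof
    fix w assume "w \<in> verts \<Gamma>"
    hence "mset (face_lengths d \<Gamma> \<epsilon> w) = mset ?L"
      using same v by (intro same_type_imp_mset_eq) blast
    thus "same_type (face_lengths d \<Gamma> \<epsilon> w) t"
      using that len3 by (intro same_type_length_3) auto
  qed
  have "\<forall>l\<in>set ?L. even l \<and> 4 \<le> l"
    using face_lengths_even[OF reg arr _ v] L4 assms(1) by simp
  from even_triples_reciprocal_sum_gt_half[OF len3 this sum]
  have types: "embedding_type d \<Gamma> \<epsilon> [4, 6, 8] \<or> embedding_type d \<Gamma> \<epsilon> [4, 6, 10] \<or>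
      embedding_type d \<Gamma> \<epsilon> [6, 6, 4] \<or> (\<exists>q\<ge>4. even q \<and> embedding_type d \<Gamma> \<epsilon> [4, 4, q])"
    using typeI by blast
  \<comment> \<open>With \<open>d = 2\<close> the second factor in \<open>formula\<close> is the excess of the reciprocal sum over \<open>1 / 2\<close>; when that
    excess is \<open>1 / k\<close>, the formula reads \<open>chi = p / k\<close>.\<close>
  have order: "int p = chi * int k"
    if "embedding_type d \<Gamma> \<epsilon> [a, b, c]" "k > 0"
      and "1 / real a + 1 / real b + 1 / real c = 1 / 2 + 1 / real k"
    for a b c k
  proof -
    have "1 - (real d + 1) / 2 + (\<Sum>l\<leftarrow>[a, b, c]. 1 / real l) = 1 / real k"
      using that(3) unfolding d by simp
    hence "real_of_int chi = real p * (1 / real k)" using formula[OF that(1)] by (simp only:)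
    hence "real_of_int (int p) = real_of_int (chi * int k)" using that(2) by simp
    thus ?thesis by (simp only: of_int_eq_iff)
  qed
  have 1: "int p = chi * int 4" if "embedding_type d \<Gamma> \<epsilon> [4, 4, 4]"
    by (rule order[OF that]) simp_all
  have 2: "int p = chi * int 24" if "embedding_type d \<Gamma> \<epsilon> [4, 6, 8]"
    by (rule order[OF that]) simp_all
  have 3: "int p = chi * int 60" if "embedding_type d \<Gamma> \<epsilon> [4, 6, 10]"
    by (rule order[OF that]) simp_all
  have 4: "int p = chi * int 12" if "embedding_type d \<Gamma> \<epsilon> [6, 6, 4]"
    by (rule order[OF that]) simp_all
  have 5: "int p = chi * int q" if "q \<ge> 4 \<and> even q \<and> embedding_type d \<Gamma> \<epsilon> [4, 4, q]" for q
    by (rule order[of 4 4 q]) (use that in simp_all)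
  show ?thesis
  proof (intro conjI)
    show "embedding_type d \<Gamma> \<epsilon> [4, 4, 4] \<or> embedding_type d \<Gamma> \<epsilon> [4, 6, 8] \<or>
      embedding_type d \<Gamma> \<epsilon> [4, 6, 10] \<or> embedding_type d \<Gamma> \<epsilon> [6, 6, 4] \<or>
      (\<exists>q\<ge>4. even q \<and> embedding_type d \<Gamma> \<epsilon> [4, 4, q])"
      using types by blast
    show "chi = 1 \<longrightarrow> (embedding_type d \<Gamma> \<epsilon> [4, 4, 4] \<longrightarrow> p = 4) \<and>
        (embedding_type d \<Gamma> \<epsilon> [4, 6, 8] \<longrightarrow> p = 24) \<and>
        (embedding_type d \<Gamma> \<epsilon> [4, 6, 10] \<longrightarrow> p = 60) \<and>
        (embedding_type d \<Gamma> \<epsilon> [6, 6, 4] \<longrightarrow> p = 12) \<and>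
        (\<forall>q\<ge>4. even q \<and> embedding_type d \<Gamma> \<epsilon> [4, 4, q] \<longrightarrow> p = q)"
      by (intro conjI impI allI; (drule 1 | drule 2 | drule 3 | drule 4 | drule (1) conjI, drule 5); simp)
    show "chi = 2 \<longrightarrow> (embedding_type d \<Gamma> \<epsilon> [4, 4, 4] \<longrightarrow> p = 8) \<and>
        (embedding_type d \<Gamma> \<epsilon> [4, 6, 8] \<longrightarrow> p = 48) \<and>
        (embedding_type d \<Gamma> \<epsilon> [4, 6, 10] \<longrightarrow> p = 120) \<and>
        (embedding_type d \<Gamma> \<epsilon> [6, 6, 4] \<longrightarrow> p = 24) \<and>
        (\<forall>q\<ge>4. even q \<and> embedding_type d \<Gamma> \<epsilon> [4, 4, q] \<longrightarrow> p = 2 * q)"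
      by (intro conjI impI allI; (drule 1 | drule 2 | drule 3 | drule 4 | drule (1) conjI, drule 5); simp)
  qed
qed

end
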